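(* Let $A \in \mathbb{C}^{N\times n}$ be left-invertible, $x_0 \in \mathbb{C}^n$, $b = Ax_0 \in \mathbb{C}^N$ with $N \ge 2$. Let $E$ be a symmetric set of ordered pairs $(i,j)$, $i \neq j$, $i,j\in\{1,\dots,N\}$, let $D = \{(i,i): 1\le i\le N\}$, and let $B_{ij} = b_i\overline{b_j} + \varepsilon_{ij}$ for $(i,j) \in E \cup D$, where $\varepsilon_{ij} = \overline{\varepsilon_{ji}}$. Let $\sigma \ge 0$, and let $\lambda_2$ be the second smallest eigenvalue of the data-weighted graph Laplacian $L_{|b|}$. Assume $\lambda_2>0$ and $\|\varepsilon\|_1 + \sigma \leq \lambda_2/2$. Let $x \in \mathbb{C}^n$ be obtained in either of the following two ways: (i) $x$ is any vector with $\sum_{(i,j)\in E\cup D} |(Ax)_i\overline{(Ax)_j} - B_{ij}| \leq \sigma$; or (ii) $x = A^+ y_1\sqrt{\eta_1}$, where $Y\in\mathbb{C}^{N\times N}$ is any Hermitian positive semidefinite matrix with $\sum_{(i,j)\in E\cup D}|Y_{ij} - B_{ij}| \leq \sigma$, $\eta_1$ is the largest eigenvalue of $Y$, and $y_1$ is a corresponding unit-norm eigenvector. Then there exists $\alpha \in [0,2\pi)$ such that $$\frac{\|x - e^{i\alpha}x_0\|}{\|x_0\|} \leq 15\,\kappa(A)\,\sqrt{\frac{\|\varepsilon\|_1+\sigma}{\lambda_2}}.$$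
   Context: $\|\cdot\|$ is the Euclidean norm for vectors and the spectral norm for matrices. $\|\varepsilon\|_1 = \sum_{(i,j)\in E\cup D}|\varepsilon_{ij}|$ (sum over ordered pairs). $A^+$ is the Moore–Penrose pseudoinverse of $A$ and $\kappa(A) = \|A\|\,\|A^+\|$ is the condition number. "Symmetric" for $E$ means $(i,j)\in E \iff (j,i)\in E$. The data-weighted graph Laplacian $L_{|b|}$ is the real symmetric $N\times N$ matrix with entries $$(L_{|b|})_{ij} = \begin{cases} \sum_{k:(i,k)\in E}|b_k|^2 & \text{if } i=j,\\ -|b_i||b_j| & \text{if } (i,j)\in E,\\ 0 & \text{otherwise.}\end{cases}$$ Its eigenvalues are sorted in increasing order with multiplicity, $\lambda_1\le\lambda_2\le\dots\le\lambda_N$ (and $\lambda_1=0$). *)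

theory Defs
  imports "HOL-Analysis.Analysis"
begin

definition adj_mat :: "complex^'n^'m \<Rightarrow> complex^'m^'n" where
  "adj_mat A = (\<chi> i j. cnj (A $ j $ i))"

definition hermitian_mat :: "complex^'n^'n \<Rightarrow> bool" where
  "hermitian_mat A \<longleftrightarrow> adj_mat A = A"

definition psd_mat :: "complex^'n^'n \<Rightarrow> bool" where
  "psd_mat A \<longleftrightarrow> hermitian_mat A \<and> (\<forall>v. 0 \<le> Re (\<Sum>i\<in>UNIV. cnj (v $ i) * (A *v v) $ i))"

definition is_pinv :: "complex^'n^'m \<Rightarrow> complex^'m^'n \<Rightarrow> bool" where
  "is_pinv A P \<longleftrightarrow>
     A ** P ** A = A \<and> P ** A ** P = P \<and> hermitian_mat (A ** P) \<and> hermitian_mat (P ** A)"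

definition pinv :: "complex^'n^'m \<Rightarrow> complex^'m^'n" where
  "pinv A = (THE P. is_pinv A P)"

definition spectral_norm :: "complex^'n^'m \<Rightarrow> real" where
  "spectral_norm A = onorm ((*v) A)"

definition cond_number :: "complex^'n^'m \<Rightarrow> real" where
  "cond_number A = spectral_norm A * spectral_norm (pinv A)"

definition eigenvector :: "('a::field)^'n^'n \<Rightarrow> 'a^'n \<Rightarrow> 'a \<Rightarrow> bool" where
  "eigenvector M v \<mu> \<longleftrightarrow> v \<noteq> 0 \<and> M *v v = \<mu> *s v"

definition eigenvalues :: "('a::field)^'n^'n \<Rightarrow> 'a set" where
  "eigenvalues M = {\<mu>. \<exists>v. eigenvector M v \<mu>}"

definition is_largest_eigenvalue :: "complex^'n^'n \<Rightarrow> real \<Rightarrow> bool" where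
  "is_largest_eigenvalue M \<eta> \<longleftrightarrow>
     complex_of_real \<eta> \<in> eigenvalues M \<and>
     (\<forall>\<mu>::real. complex_of_real \<mu> \<in> eigenvalues M \<longrightarrow> \<mu> \<le> \<eta>)"

(* Intended for symmetric matrices, whose spectrum is real and for which the dimension of the
   eigenspace is also the multiplicity as a root of the characteristic polynomial. *)
definition sorted_eigenvalues :: "real^'n^'n \<Rightarrow> real list" where
  "sorted_eigenvalues M =
     sorted_list_of_multiset
       (\<Sum>\<mu>\<in>eigenvalues M. replicate_mset (dim {v. M *v v = \<mu> *s v}) \<mu>)"

(* List positions are counted from 0. *)
definition second_smallest_eigenvalue :: "real^'n^'n \<Rightarrow> real" where
  "second_smallest_eigenvalue M = sorted_eigenvalues M ! 1"

definition weighted_laplacian :: "('m \<times> 'm) set \<Rightarrow> complex^'m \<Rightarrow> real^'m^'m" where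
  "weighted_laplacian E b =
     (\<chi> i j. if i = j then (\<Sum>k\<in>{k. (i, k) \<in> E}. (norm (b $ k))\<^sup>2)
            else if (i, j) \<in> E then - (norm (b $ i) * norm (b $ j))
            else 0)"

end

theory Submission
  imports Defs
begin

text \<open>
  Let \<open>\<delta>\<close> be the noise plus the misfit, so that the measured entries of a positive semidefinite
  matrix \<open>Y\<close> differ from those of \<open>b b\<^sup>*\<close> by at most \<open>\<delta>\<close> in the entrywise 1-norm. In the first way of
  obtaining \<open>x\<close>, this matrix is \<open>(A x) (A x)\<^sup>*\<close>.

  Once the phases of \<open>b\<close> are removed, the Laplacian \<open>L\<close> annihilates the rank-one matrix of \<open>b\<close>
  and has nonzero entries only at measured positions. Its trace against \<open>Y\<close> therefore sees only the
  deviation and is at most \<open>|b|\<^sup>2 \<delta>\<close>. On the complement of its kernel vector \<open>L\<close> is bounded below by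
  \<open>\<lambda>\<^sub>2\<close>, so the same trace is at least \<open>\<lambda>\<^sub>2\<close> times the part of \<open>Y\<close> off the direction
  of \<open>b\<close> (\<open>second_eigenvalue_trace_bound\<close>). Hence this part is at most \<open>|b|\<^sup>2 \<delta> / \<lambda>\<^sub>2\<close>
  (\<open>psd_near_rank_one\<close>). It is a global statement about \<open>Y\<close>, although only the entries on the graph
  are controlled; positive semidefiniteness carries it over.

  The diagonal is measured, so the trace of \<open>Y\<close> is within \<open>\<delta>\<close> of \<open>|b|\<^sup>2\<close>. Together these bounds
  make the leading eigenvalue of \<open>Y\<close> nearly \<open>|b|\<^sup>2\<close> and its eigenvector nearly parallel to \<open>b\<close>: the
  scaled leading eigenvector \<open>z\<close> satisfies \<open>|z - e\<^bsup>i\<alpha>\<^esup> b|\<^sup>2 \<le> 7 |b|\<^sup>2 \<delta> / \<lambda>\<^sub>2\<close> for the phase that aligns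
  the two (\<open>leading_factor_close\<close>). The pseudoinverse carries \<open>z\<close> to \<open>x\<close> and \<open>b\<close> to \<open>x\<^sub>0\<close>, which
  costs the factor \<open>\<kappa>(A)\<close>; the constant 15 leaves room above the square root of 7.
\<close>

section \<open>Eigenvectors of self-adjoint maps\<close>

text \<open>The maximiser exists because the unit sphere of \<open>S\<close> is compact; that it is an eigenvector is the
  first-order condition at the maximum. The maximality clause is what later identifies the largest
  eigenvalue of a Hermitian matrix with the maximum of its form.\<close>

lemma rayleigh_maximiser:
  fixes f :: "'a::euclidean_space \<Rightarrow> 'a"
  assumes f: "linear f"
    and sym: "\<And>v w. v \<bullet> f w = f v \<bullet> w"
    and S: "subspace S" "f ` S \<subseteq> S" "S \<noteq> {0}"
  obtains v where "v \<in> S" "norm v = 1" "f v = (v \<bullet> f v) *\<^sub>R v"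
    "\<And>w. w \<in> S \<Longrightarrow> w \<bullet> f w \<le> (v \<bullet> f v) * (norm w)\<^sup>2"
proof -
  let ?K = "S \<inter> sphere 0 1"
  have "0 \<in> S"
    using S(1) by (rule subspace_0)
  then obtain u where u: "u \<in> S" "u \<noteq> 0"
    using S(3) by blast
  have ne: "u /\<^sub>R norm u \<in> ?K"
    using u S(1) by (simp add: subspace_scale)
  have "compact ?K"
    using S(1) by (intro closed_Int_compact closed_subspace compact_sphere)
  moreover have "continuous_on ?K (\<lambda>v. v \<bullet> f v)"
    using f by (intro continuous_intros linear_continuous_on linear_conv_bounded_linear[THEN iffD1])
  ultimately obtain v where v: "v \<in> ?K" and vmax: "\<And>w. w \<in> ?K \<Longrightarrow> w \<bullet> f w \<le> v \<bullet> f v"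
    using continuous_attains_sup[of ?K "\<lambda>v. v \<bullet> f v"] ne by blast
  define l where "l = v \<bullet> f v"
  have vS: "v \<in> S" and nv: "norm v = 1"
    using v by auto
  have bound: "w \<bullet> f w \<le> l * (norm w)\<^sup>2" if w: "w \<in> S" for w
  proof (cases "w = 0")
    case False
    then have "w /\<^sub>R norm w \<in> ?K"
      using w S(1) by (simp add: subspace_scale)
    then have "(w /\<^sub>R norm w) \<bullet> f (w /\<^sub>R norm w) \<le> l"
      unfolding l_def by (rule vmax)
    then have "(w \<bullet> f w) / (norm w)\<^sup>2 \<le> l"
      using f by (simp add: linear_cmul power2_eq_square divide_simps split: if_splits)
    then show ?thesis
      using False by (simp add: divide_simps mult.commute)
  qed (simp add: f linear_0)
  \<comment> \<open>The quadratic form \<open>l |w|\<^sup>2 - w \<bullet> f w\<close> is nonnegative on \<open>S\<close> and vanishes at \<open>v\<close>, so moving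
    from \<open>v\<close> in the direction of its gradient would make it negative unless the gradient is zero.\<close>
  define w where "w = l *\<^sub>R v - f v"
  define g where "g = l * (norm w)\<^sup>2 - w \<bullet> f w"
  define c where "c = (norm w)\<^sup>2"
  have wS: "w \<in> S"
    unfolding w_def using vS S by (auto intro!: subspace_diff subspace_scale)
  have g0: "g \<ge> 0"
    unfolding g_def using bound[OF wS] by simp
  have vv: "v \<bullet> v = 1"
    using nv by (simp add: norm_eq_1)
  have quad: "2 * t * c + t\<^sup>2 * g \<ge> 0" for t
  proof -
    have "v + t *\<^sub>R w \<in> S"
      using vS wS S(1) by (auto intro!: subspace_add subspace_scale)
    from bound[OF this]
    have "0 \<le> l * (norm (v + t *\<^sub>R w))\<^sup>2 - (v + t *\<^sub>R w) \<bullet> f (v + t *\<^sub>R w)"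
      by simp
    also have "(v + t *\<^sub>R w) \<bullet> f (v + t *\<^sub>R w) = l + 2 * t * (w \<bullet> f v) + t\<^sup>2 * (w \<bullet> f w)"
      using f sym[of v w] by (simp add: linear_add linear_cmul inner_add_left inner_add_right
          inner_commute l_def power2_eq_square algebra_simps)
    also have "(norm (v + t *\<^sub>R w))\<^sup>2 = 1 + 2 * t * (w \<bullet> v) + t\<^sup>2 * (norm w)\<^sup>2"
      unfolding power2_norm_eq_inner
      by (simp add: inner_add_left inner_add_right vv inner_commute power2_eq_square algebra_simps)
    also have "l * (1 + 2 * t * (w \<bullet> v) + t\<^sup>2 * (norm w)\<^sup>2) -
        (l + 2 * t * (w \<bullet> f v) + t\<^sup>2 * (w \<bullet> f w)) = 2 * t * (l * (w \<bullet> v) - w \<bullet> f v) + t\<^sup>2 * g"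
      unfolding g_def by (simp add: algebra_simps)
    also have "l * (w \<bullet> v) - w \<bullet> f v = w \<bullet> (l *\<^sub>R v - f v)"
      by (simp add: inner_diff_right)
    also have "\<dots> = c"
      unfolding c_def power2_norm_eq_inner by (simp only: w_def)
    finally show ?thesis .
  qed
  have "c = 0"
  proof -
    define s where "s = c / (g + 1)"
    have c: "c = s * (g + 1)"
      using g0 by (simp add: s_def)
    have "- s\<^sup>2 * (g + 2) = 2 * (- s) * c + (- s)\<^sup>2 * g"
      unfolding c by (simp add: power2_eq_square algebra_simps)
    also have "\<dots> \<ge> 0"
      by (rule quad)
    finally have "s\<^sup>2 * (g + 2) \<le> 0"
      by simp
    then have "s\<^sup>2 \<le> 0"
      using g0 by (simp add: mult_le_0_iff)
    then show ?thesis
      using c by simp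
  qed
  then have "f v = (v \<bullet> f v) *\<^sub>R v"
    by (simp add: c_def w_def l_def)
  then show ?thesis
    using that vS nv bound unfolding l_def by blast
qed

definition orthonormal :: "'a::real_inner set \<Rightarrow> bool" where
  "orthonormal B \<longleftrightarrow> pairwise orthogonal B \<and> (\<forall>v\<in>B. norm v = 1)"

lemma orthonormal_independent: "orthonormal B \<Longrightarrow> independent B"
  unfolding orthonormal_def by (rule pairwise_orthogonal_independent) auto

lemma orthonormal_inner:
  "orthonormal B \<Longrightarrow> v \<in> B \<Longrightarrow> w \<in> B \<Longrightarrow> v \<bullet> w = (if v = w then 1 else 0)"
  unfolding orthonormal_def pairwise_def orthogonal_def by (auto simp: norm_eq_1)

lemma parseval_inner:
  fixes B :: "'a::euclidean_space set"
  assumes B: "orthonormal B" "span B = UNIV"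
  shows "(\<Sum>v\<in>B. (x \<bullet> v) * (v \<bullet> y)) = x \<bullet> y"
proof -
  have fin: "finite B"
    using orthonormal_independent[OF B(1)] by (rule independent_imp_finite)
  define z where "z = x - (\<Sum>v\<in>B. (x \<bullet> v) *\<^sub>R v)"
  have "orthogonal z w" if w: "w \<in> B" for w
  proof -
    have "(\<Sum>v\<in>B. (x \<bullet> v) * (v \<bullet> w)) = (\<Sum>v\<in>B. if v = w then x \<bullet> v else 0)"
      by (rule sum.cong) (use B(1) w in \<open>auto simp: orthonormal_inner\<close>)
    then show ?thesis
      using fin w by (simp add: orthogonal_def z_def inner_diff_left inner_sum_left)
  qed
  then have "orthogonal z z"
    using orthogonal_to_span[of z B z] B(2) by simp
  then have "z = 0"
    by (simp add: orthogonal_self)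
  then have "x = (\<Sum>v\<in>B. (x \<bullet> v) *\<^sub>R v)"
    by (simp add: z_def)
  then have "x \<bullet> y = (\<Sum>v\<in>B. (x \<bullet> v) *\<^sub>R v) \<bullet> y"
    by simp
  then show ?thesis
    by (simp add: inner_sum_left)
qed

text \<open>The spectral theorem with one basis vector prescribed. In an orthonormal set of eigenvectors
  through \<open>u\<close> of maximal cardinality, the orthogonal complement of the span is invariant under \<open>f\<close>,
  so it must be trivial: it would otherwise contain a further eigenvector.\<close>

lemma orthonormal_eigenvectors_extend:
  fixes f :: "'a::euclidean_space \<Rightarrow> 'a"
  assumes f: "linear f"
    and sym: "\<And>v w. v \<bullet> f w = f v \<bullet> w"
    and u: "norm u = 1" "f u = m *\<^sub>R u"
  obtains B where "u \<in> B" "orthonormal B" "span B = UNIV"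
    "\<And>v. v \<in> B \<Longrightarrow> f v = (v \<bullet> f v) *\<^sub>R v"
proof -
  define good where
    "good B \<longleftrightarrow> u \<in> B \<and> orthonormal B \<and> (\<forall>v\<in>B. f v = (v \<bullet> f v) *\<^sub>R v)" for B
  have "good {u}"
    using u by (auto simp: good_def orthonormal_def norm_eq_1)
  moreover have "card B < Suc (DIM('a))" if "good B" for B
    using that independent_bound[of B] orthonormal_independent[of B] by (auto simp: good_def)
  ultimately obtain B where B: "good B" and Bmax: "\<And>C. good C \<Longrightarrow> card C \<le> card B"
    using ex_has_greatest_nat[of good "{u}" card "Suc (DIM('a))"] by auto
  have fin: "finite B"
    using B orthonormal_independent independent_imp_finite unfolding good_def by blast
  have "span B = UNIV"
  proof (rule ccontr)
    assume "span B \<noteq> UNIV"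
    define S where "S = {x. \<forall>v\<in>B. orthogonal v x}"
    have "subspace S"
      unfolding S_def by (rule subspace_orthogonal_to_vectors)
    moreover have "f ` S \<subseteq> S"
    proof clarify
      fix x assume x: "x \<in> S"
      have "v \<bullet> f x = 0" if v: "v \<in> B" for v
      proof -
        have "v \<bullet> f x = ((v \<bullet> f v) *\<^sub>R v) \<bullet> x"
          using B v sym[of v x] unfolding good_def by metis
        then show ?thesis
          using x v by (simp add: S_def orthogonal_def)
      qed
      then show "f x \<in> S"
        by (simp add: S_def orthogonal_def)
    qed
    moreover have "S \<noteq> {0}"
    proof -
      have "dim B < DIM('a)"
        using \<open>span B \<noteq> UNIV\<close> dim_eq_full[of B] dim_subset_UNIV[of B] by linarith
      then obtain x where "x \<noteq> 0" "\<And>y. y \<in> span B \<Longrightarrow> orthogonal x y"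
        using orthogonal_to_subspace_exists by blast
      then have "x \<in> S"
        by (auto simp: S_def orthogonal_commute span_base)
      with \<open>x \<noteq> 0\<close> show ?thesis by blast
    qed
    ultimately obtain v where v: "v \<in> S" "norm v = 1" "f v = (v \<bullet> f v) *\<^sub>R v"
      by (rule rayleigh_maximiser[OF f sym]) iprover
    have "orthonormal B"
      using B unfolding good_def by blast
    then have "orthonormal (insert v B)"
      using v(1,2) unfolding orthonormal_def pairwise_insert S_def
      by (auto simp: orthogonal_commute)
    then have "good (insert v B)"
      using B v(3) unfolding good_def by blast
    moreover have "v \<notin> B"
      using v(1,2) by (auto simp: S_def orthogonal_def norm_eq_1)
    ultimately show False
      using Bmax[of "insert v B"] fin by simp
  qed
  then show ?thesis
    using that B unfolding good_def by blast
qed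

lemma trace_orthonormal_basis:
  fixes M :: "real^'n^'n"
  assumes B: "orthonormal B" "span B = UNIV"
  shows "(\<Sum>v\<in>B. v \<bullet> (M *v v)) = trace M"
proof -
  have "(\<Sum>v\<in>B. v \<bullet> (M *v v)) = (\<Sum>v\<in>B. \<Sum>i\<in>UNIV. \<Sum>j\<in>UNIV. M $ i $ j * (v $ i * v $ j))"
    by (simp add: inner_vec_def matrix_vector_mult_def sum_distrib_left mult_ac)
  also have "\<dots> = (\<Sum>i\<in>UNIV. \<Sum>j\<in>UNIV. M $ i $ j * (\<Sum>v\<in>B. v $ i * v $ j))"
    unfolding sum.swap[of _ _ B] by (simp add: sum_distrib_left)
  also have "\<dots> = (\<Sum>i\<in>UNIV. \<Sum>j\<in>UNIV. M $ i $ j * (if i = j then 1 else 0))"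
  proof -
    have "(\<Sum>v\<in>B. v $ i * v $ j) = (if i = j then 1 else 0)" for i j
      using parseval_inner[OF B, of "axis i 1" "axis j 1"]
      by (simp add: inner_axis inner_axis') (simp add: axis_def)
    then show ?thesis by simp
  qed
  finally show ?thesis
    by (simp add: trace_def if_distrib cong: if_cong)
qed

section \<open>The second smallest eigenvalue of a symmetric matrix\<close>

text \<open>Two of the elements are at most \<open>max x y\<close>, and they cannot both be the first one.\<close>

lemma second_of_sorted_le:
  fixes M :: "'a::linorder multiset"
  assumes "{#x, y#} \<subseteq># M"
  shows "sorted_list_of_multiset M ! 1 \<le> max x y"
proof (rule ccontr)
  assume contr: "\<not> ?thesis"
  let ?P = "\<lambda>z. z \<le> max x y"
  have "filter_mset ?P {#x, y#} \<subseteq># filter_mset ?P M"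
    using assms by (rule multiset_filter_mono)
  then have sz: "2 \<le> size (filter_mset ?P M)"
    using size_mset_mono by fastforce
  obtain xs where xs: "xs = sorted_list_of_multiset M" by simp
  have srt: "sorted xs" and M: "mset xs = M"
    by (simp_all add: xs)
  have "length xs \<ge> 2"
    using size_mset_mono[OF assms] M by (metis size_mset size_add_mset size_empty numeral_2_eq_2 One_nat_def)
  then obtain h k ys where ys: "xs = h # k # ys"
    by (cases xs; cases "tl xs") auto
  have "\<not> ?P k"
    using contr ys xs by (metis nth_Cons_0 nth_Cons_Suc One_nat_def)
  then have "\<not> ?P z" if "z \<in> set (k # ys)" for z
    using that srt ys by auto
  then have "filter ?P (k # ys) = []"
    by (meson filter_False)
  then have "length (filter ?P xs) \<le> 1"
    unfolding ys by simp
  moreover have "length (filter ?P xs) = size (filter_mset ?P M)"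
    by (metis M mset_filter size_mset)
  ultimately show False
    using sz by simp
qed

lemma symmetric_matrix_inner:
  fixes M :: "real^'n^'n"
  assumes "transpose M = M"
  shows "v \<bullet> (M *v w) = (M *v v) \<bullet> w"
  by (metis assms dot_lmul_matrix vector_transpose_matrix)

lemma eigenvectors_orthogonal:
  fixes M :: "real^'n^'n"
  assumes "transpose M = M" "M *v u = \<mu> *s u" "M *v v = \<nu> *s v" "\<mu> \<noteq> \<nu>"
  shows "orthogonal u v"
proof -
  have "\<nu> * (u \<bullet> v) = \<mu> * (u \<bullet> v)"
    using symmetric_matrix_inner[OF assms(1), of u v] assms(2,3) by (simp add: scalar_mult_eq_scaleR)
  then show ?thesis
    using assms(4) by (simp add: orthogonal_def)
qed

lemma finite_eigenvalues:
  fixes M :: "real^'n^'n"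
  assumes M: "transpose M = M"
  shows "finite (eigenvalues M)"
proof -
  define w where "w \<mu> = (SOME v. eigenvector M v \<mu>)" for \<mu>
  have w: "eigenvector M (w \<mu>) \<mu>" if "\<mu> \<in> eigenvalues M" for \<mu>
    using that unfolding eigenvalues_def w_def by (auto intro: someI_ex)
  have orth: "orthogonal (w \<mu>) (w \<nu>)" if "\<mu> \<in> eigenvalues M" "\<nu> \<in> eigenvalues M" "\<mu> \<noteq> \<nu>" for \<mu> \<nu>
    using eigenvectors_orthogonal[OF M] w that unfolding eigenvector_def by blast
  have nz: "w \<mu> \<noteq> 0" if "\<mu> \<in> eigenvalues M" for \<mu>
    using w that unfolding eigenvector_def by blast
  have "pairwise orthogonal (w ` eigenvalues M)"
    unfolding pairwise_def using orth by blast
  moreover have "0 \<notin> w ` eigenvalues M"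
    using nz by force
  ultimately have "finite (w ` eigenvalues M)"
    by (intro independent_imp_finite pairwise_orthogonal_independent)
  moreover have "inj_on w (eigenvalues M)"
    by (rule inj_onI) (metis orth nz orthogonal_self)
  ultimately show ?thesis
    by (rule finite_imageD)
qed

text \<open>This is how the sorted spectrum enters the argument: it turns \<open>\<lambda>\<^sub>2\<close> into a lower bound for every
  eigenvalue on the complement of a known kernel vector. Multiplicities matter only when
  \<open>\<mu> = \<nu>\<close>, where the eigenspace contains two independent vectors.\<close>

lemma second_smallest_eigenvalue_le:
  fixes M :: "real^'n^'n"
  assumes M: "transpose M = M"
    and u: "u \<noteq> 0" "M *v u = \<mu> *\<^sub>R u"
    and v: "v \<noteq> 0" "M *v v = \<nu> *\<^sub>R v"
    and uv: "orthogonal u v"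
  shows "second_smallest_eigenvalue M \<le> max \<mu> \<nu>"
proof -
  let ?d = "\<lambda>\<mu>. dim {v. M *v v = \<mu> *s v}"
  define W where "W = (\<Sum>\<mu>\<in>eigenvalues M. replicate_mset (?d \<mu>) \<mu>)"
  have mem: "\<mu> \<in> eigenvalues M" "\<nu> \<in> eigenvalues M"
    using u v by (auto simp: eigenvalues_def eigenvector_def scalar_mult_eq_scaleR)
  have count: "count W \<kappa> = ?d \<kappa>" if "\<kappa> \<in> eigenvalues M" for \<kappa>
    using that finite_eigenvalues[OF M] unfolding W_def by (simp add: count_sum if_distrib cong: if_cong)
  have dim_ge: "card X \<le> ?d \<kappa>" if "X \<subseteq> {v. M *v v = \<kappa> *s v}" "X \<subseteq> {u, v}" for X \<kappa>
  proof -
    have "independent X"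
      using that(2) u(1) v(1) uv orthogonal_commute[of u v]
      by (intro pairwise_orthogonal_independent) (auto simp: pairwise_def)
    then show ?thesis
      using that(1) by (metis dim_eq_card_independent dim_subset)
  qed
  have "u \<noteq> v"
    using uv u(1) by (auto simp: orthogonal_self)
  have "{#\<mu>, \<nu>#} \<subseteq># W"
  proof (cases "\<mu> = \<nu>")
    case True
    have "card {u, v} \<le> ?d \<mu>"
      by (rule dim_ge) (use u v True in \<open>auto simp: scalar_mult_eq_scaleR\<close>)
    then show ?thesis
      using True count[OF mem(1)] \<open>u \<noteq> v\<close> by (simp add: subseteq_mset_def)
  next
    case False
    have "card {u} \<le> ?d \<mu>" "card {v} \<le> ?d \<nu>"
      by (rule dim_ge; use u v in \<open>auto simp: scalar_mult_eq_scaleR\<close>)+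
    then show ?thesis
      using False count[OF mem(1)] count[OF mem(2)]
      by (auto simp: subseteq_mset_def Suc_le_eq count_greater_zero_iff[symmetric]
          simp del: count_greater_zero_iff)
  qed
  then show ?thesis
    unfolding second_smallest_eigenvalue_def sorted_eigenvalues_def W_def
    by (rule second_of_sorted_le)
qed

text \<open>Write the trace in an orthonormal eigenbasis of \<open>M\<close> that contains the normalised kernel vector
  \<open>a\<close>. That vector contributes nothing, and every other one contributes its eigenvalue times a
  nonnegative value of the form \<open>S\<close>. Replacing each of those eigenvalues by the second smallest leaves
  the trace of \<open>S\<close> minus its part along \<open>a\<close>.\<close>

lemma second_eigenvalue_trace_bound:
  fixes M S :: "real^'n^'n"
  assumes M: "transpose M = M" "M *v a = 0" and a: "a \<noteq> 0"
    and pos: "0 < second_smallest_eigenvalue M"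
    and S: "\<And>v. 0 \<le> v \<bullet> (S *v v)"
  shows "second_smallest_eigenvalue M * (trace S - (a \<bullet> (S *v a)) / (norm a)\<^sup>2) \<le> trace (S ** M)"
proof -
  let ?l = "second_smallest_eigenvalue M"
  define u where "u = a /\<^sub>R norm a"
  have Mu: "M *v u = 0"
    unfolding u_def using M(2) by (simp add: matrix_vector_mult_scaleR)
  have "linear ((*v) M)"
    by (rule matrix_vector_mul_linear)
  moreover have "norm u = 1" "M *v u = 0 *\<^sub>R u"
    using a Mu by (simp_all add: u_def)
  ultimately obtain B where uB: "u \<in> B" and B: "orthonormal B" "span B = UNIV"
    and eig: "\<And>v. v \<in> B \<Longrightarrow> M *v v = (v \<bullet> (M *v v)) *\<^sub>R v"
    by (rule orthonormal_eigenvectors_extend[of "(*v) M", OF _ symmetric_matrix_inner[OF M(1)]]) iprover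
  have fin: "finite B"
    using orthonormal_independent[OF B(1)] by (rule independent_imp_finite)
  have nz: "v \<noteq> 0" if "v \<in> B" for v
    using that B(1) by (auto simp: orthonormal_def)
  have ge: "?l \<le> v \<bullet> (M *v v)" if v: "v \<in> B" "v \<noteq> u" for v
  proof -
    have "orthogonal u v"
      using B(1) uB v by (auto simp: orthonormal_def pairwise_def)
    from second_smallest_eigenvalue_le[OF M(1) nz[OF uB] _ nz[OF v(1)] eig[OF v(1)] this, of 0]
    show ?thesis
      using Mu pos by simp
  qed
  have "a \<bullet> (S *v a) / (norm a)\<^sup>2 = u \<bullet> (S *v u)"
    using a by (simp add: u_def matrix_vector_mult_scaleR power2_eq_square divide_simps)
  then have "?l * (trace S - (a \<bullet> (S *v a)) / (norm a)\<^sup>2)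
      = ?l * ((\<Sum>v\<in>B. v \<bullet> (S *v v)) - u \<bullet> (S *v u))"
    by (simp add: trace_orthonormal_basis[OF B])
  also have "\<dots> = (\<Sum>v\<in>B - {u}. ?l * (v \<bullet> (S *v v)))"
    using fin uB by (simp add: sum_diff1 sum_distrib_left right_diff_distrib)
  also have "\<dots> \<le> (\<Sum>v\<in>B - {u}. (v \<bullet> (M *v v)) * (v \<bullet> (S *v v)))"
    using ge S by (intro sum_mono mult_right_mono) auto
  also have "\<dots> = (\<Sum>v\<in>B. (v \<bullet> (M *v v)) * (v \<bullet> (S *v v)))"
    using fin uB Mu by (simp add: sum_diff1)
  also have "\<dots> = (\<Sum>v\<in>B. v \<bullet> ((S ** M) *v v))"
  proof (rule sum.cong)
    fix v assume "v \<in> B"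
    have "(S ** M) *v v = S *v (M *v v)"
      by (simp add: matrix_vector_mul_assoc)
    also have "\<dots> = S *v ((v \<bullet> (M *v v)) *\<^sub>R v)"
      using eig[OF \<open>v \<in> B\<close>] by metis
    finally show "(v \<bullet> (M *v v)) * (v \<bullet> (S *v v)) = v \<bullet> ((S ** M) *v v)"
      by (simp add: matrix_vector_mult_scaleR)
  qed simp
  also have "\<dots> = trace (S ** M)"
    by (rule trace_orthonormal_basis[OF B])
  finally show ?thesis .
qed

section \<open>The data-weighted graph Laplacian\<close>

lemma norm_vec_power2: "(norm v)\<^sup>2 = (\<Sum>i\<in>UNIV. (norm (v $ i))\<^sup>2)"
  by (simp add: norm_vec_def L2_set_def sum_nonneg)

definition modulus :: "complex^'m \<Rightarrow> real^'m" where
  "modulus b = (\<chi> i. norm (b $ i))"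

lemma modulus_nth: "modulus b $ i = norm (b $ i)"
  by (simp add: modulus_def)

lemma norm_modulus: "norm (modulus b) = norm b"
  by (simp add: norm_vec_def modulus_def L2_set_def)

lemma laplacian_symmetric: "sym E \<Longrightarrow> transpose (weighted_laplacian E b) = weighted_laplacian E b"
  by (auto simp: vec_eq_iff transpose_def weighted_laplacian_def mult.commute dest: symD)

lemma laplacian_modulus:
  assumes "\<forall>(i, j)\<in>E. i \<noteq> j"
  shows "weighted_laplacian E b *v modulus b = 0"
proof -
  have "(weighted_laplacian E b *v modulus b) $ i = 0" for i
  proof -
    have "(weighted_laplacian E b *v modulus b) $ i
        = (\<Sum>j\<in>UNIV. (if j = i then (\<Sum>k\<in>{k. (i, k) \<in> E}. (norm (b $ k))\<^sup>2) * norm (b $ i) else 0)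
            + (if (i, j) \<in> E then - (norm (b $ i) * (norm (b $ j))\<^sup>2) else 0))"
      unfolding matrix_vector_mult_def vec_lambda_beta
      by (rule sum.cong) (use assms in \<open>auto simp: weighted_laplacian_def modulus_def power2_eq_square\<close>)
    also have "\<dots> = 0"
      by (simp add: sum.distrib sum.If_cases sum_negf sum_distrib_left mult.commute)
    finally show ?thesis .
  qed
  then show ?thesis
    by (simp add: vec_eq_iff)
qed

lemma laplacian_diagonal_le:
  assumes "\<forall>(i, j)\<in>E. i \<noteq> j"
  shows "weighted_laplacian E b $ i $ i \<le> (norm b)\<^sup>2 - (norm (b $ i))\<^sup>2"
proof -
  have "(\<Sum>k\<in>{k. (i, k) \<in> E}. (norm (b $ k))\<^sup>2) \<le> (\<Sum>k\<in>UNIV - {i}. (norm (b $ k))\<^sup>2)"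
    using assms by (intro sum_mono2) auto
  also have "\<dots> = (norm b)\<^sup>2 - (norm (b $ i))\<^sup>2"
    by (simp add: norm_vec_power2 sum_diff1)
  finally show ?thesis
    by (simp add: weighted_laplacian_def)
qed

lemma laplacian_entry_le:
  assumes "\<forall>(i, j)\<in>E. i \<noteq> j"
  shows "\<bar>weighted_laplacian E b $ i $ j\<bar> \<le> (norm b)\<^sup>2"
proof (cases "i = j")
  case True
  have "0 \<le> weighted_laplacian E b $ i $ i"
    by (simp add: weighted_laplacian_def sum_nonneg)
  then show ?thesis
    using laplacian_diagonal_le[OF assms, of b i] True by (simp add: abs_of_nonneg) (smt (verit) zero_le_power2)
next
  case False
  have "norm (b $ i) * norm (b $ j) \<le> norm b * norm b"
    by (intro mult_mono Finite_Cartesian_Product.norm_nth_le) auto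
  then show ?thesis
    using False by (simp add: weighted_laplacian_def power2_eq_square)
qed

lemma two_indices:
  assumes "CARD('m::finite) \<ge> 2"
  obtains i j :: "'m::finite" where "i \<noteq> j"
  using assms card_le_Suc0_iff_eq[of "UNIV :: 'm set"] by (auto simp: numeral_2_eq_2 not_less_eq_eq)

lemma laplacian_positive_imp_nonzero:
  fixes b :: "complex^'m"
  assumes "CARD('m) \<ge> 2" and pos: "0 < second_smallest_eigenvalue (weighted_laplacian E b)"
  shows "b \<noteq> 0"
proof
  assume "b = 0"
  then have L: "weighted_laplacian E b = 0"
    by (simp add: vec_eq_iff weighted_laplacian_def)
  obtain i j :: 'm where "i \<noteq> j"
    using two_indices[OF assms(1)] by blast
  then have "second_smallest_eigenvalue (0 :: real^'m^'m) \<le> max 0 0"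
    by (intro second_smallest_eigenvalue_le[of _ "axis i 1" _ "axis j 1"])
      (simp_all add: axis_eq_0_iff orthogonal_def inner_axis_axis, simp add: vec_eq_iff transpose_def)
  then show False
    using pos L by simp
qed

text \<open>Apply the trace bound to the coordinate projection onto a vertex \<open>k\<close> that does not carry all of
  the weight of \<open>b\<close>: the diagonal entry of the Laplacian at \<open>k\<close> is at most the weight of the other
  vertices. In the final estimate this bound absorbs the trace error \<open>\<delta>\<close> into
  \<open>|b|\<^sup>2 \<delta> / \<lambda>\<^sub>2\<close>.\<close>

lemma laplacian_second_eigenvalue_le:
  fixes b :: "complex^'m"
  assumes N: "CARD('m) \<ge> 2" and E: "sym E" "\<forall>(i, j)\<in>E. i \<noteq> j"
    and pos: "0 < second_smallest_eigenvalue (weighted_laplacian E b)"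
  shows "second_smallest_eigenvalue (weighted_laplacian E b) \<le> (norm b)\<^sup>2"
proof -
  let ?L = "weighted_laplacian E b"
  have b: "b \<noteq> 0"
    using N pos by (rule laplacian_positive_imp_nonzero)
  obtain i j :: 'm where ij: "i \<noteq> j"
    using two_indices[OF N] by blast
  \<comment> \<open>Two vertices cannot both carry the full positive weight, so one of them can serve as \<open>k\<close>.\<close>
  have "(norm (b $ i))\<^sup>2 + (norm (b $ j))\<^sup>2 = (\<Sum>k\<in>{i, j}. (norm (b $ k))\<^sup>2)"
    using ij by simp
  also have "\<dots> \<le> (norm b)\<^sup>2"
    unfolding norm_vec_power2[of b] by (rule sum_mono2) auto
  finally have "(norm (b $ i))\<^sup>2 + (norm (b $ j))\<^sup>2 \<le> (norm b)\<^sup>2" .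
  moreover have "0 < (norm b)\<^sup>2"
    using b by simp
  ultimately obtain k where k: "(norm (b $ k))\<^sup>2 < (norm b)\<^sup>2"
    by (metis add_strict_mono linorder_not_less less_add_same_cancel1 order_less_le_trans order_le_less)
  define S :: "real^'m^'m" where "S = (\<chi> p q. if p = k \<and> q = k then 1 else 0)"
  have Sv: "S *v v = axis k (v $ k)" for v
    by (auto simp: S_def vec_eq_iff matrix_vector_mult_def axis_def if_distrib if_distribR cong: if_cong)
  have "modulus b \<noteq> 0"
    using b norm_modulus[of b] by auto
  moreover have "0 \<le> v \<bullet> (S *v v)" for v
    by (simp add: Sv inner_axis)
  ultimately have "second_smallest_eigenvalue ?L * (trace S - (modulus b \<bullet> (S *v modulus b)) / (norm (modulus b))\<^sup>2)
      \<le> trace (S ** ?L)"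
    by (rule second_eigenvalue_trace_bound[OF laplacian_symmetric[OF E(1)] laplacian_modulus[OF E(2)] _ pos])
  moreover have "trace S = 1"
    by (simp add: S_def trace_def)
  moreover have "(S ** ?L) $ i $ i = (if i = k then ?L $ k $ k else 0)" for i
    by (cases "i = k") (simp_all add: S_def matrix_matrix_mult_def if_distrib if_distribR cong: if_cong)
  then have "trace (S ** ?L) = ?L $ k $ k"
    by (simp add: trace_def)
  ultimately have "second_smallest_eigenvalue ?L * (1 - (norm (b $ k))\<^sup>2 / (norm b)\<^sup>2) \<le> (norm b)\<^sup>2 - (norm (b $ k))\<^sup>2"
    using laplacian_diagonal_le[OF E(2), of b k]
    by (simp add: Sv norm_modulus inner_axis modulus_nth power2_eq_square)
  also have "\<dots> = (norm b)\<^sup>2 * (1 - (norm (b $ k))\<^sup>2 / (norm b)\<^sup>2)"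
    using b by (simp add: field_simps)
  finally show ?thesis
    using k b by (simp add: mult_le_cancel_right divide_simps split: if_splits)
qed

section \<open>Hermitian forms\<close>

definition cdot :: "complex^'n \<Rightarrow> complex^'n \<Rightarrow> complex" where
  "cdot v w = (\<Sum>i\<in>UNIV. cnj (v $ i) * w $ i)"

lemma inner_eq_Re_cdot: "v \<bullet> w = Re (cdot v w)"
  by (simp add: cdot_def inner_vec_def inner_complex_def)

lemma cdot_scale: "cdot v (c *s w) = c * cdot v w" "cdot (c *s v) w = cnj c * cdot v w"
  by (simp_all add: cdot_def sum_distrib_left mult_ac)

lemma norm_scale: "norm (c *s v) = norm c * norm (v :: complex^'n)"
  by (simp add: norm_vec_def norm_mult L2_set_right_distrib)

lemma cdot_adj: "cdot v (adj_mat A *v w) = cdot (A *v v) w"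
  unfolding cdot_def matrix_vector_mult_def adj_mat_def
  by (simp add: sum_distrib_left sum_distrib_right mult_ac) (rule sum.swap)

lemma cdot_self: "cdot v v = of_real ((norm v)\<^sup>2)"
  unfolding cdot_def norm_vec_power2 of_real_sum complex_norm_square by (simp add: mult.commute)

lemma linear_matrix_vector_complex: "linear ((*v) (A :: complex^'n^'m))"
  by (rule linearI) (simp_all add: vec_eq_iff matrix_vector_mult_def scaleR_sum_right algebra_simps sum.distrib)

lemma psd_mat_iff: "psd_mat T \<longleftrightarrow> hermitian_mat T \<and> (\<forall>v. 0 \<le> v \<bullet> (T *v v))"
  by (simp add: psd_mat_def inner_eq_Re_cdot cdot_def)

lemma exists_aligning_phase:
  obtains \<alpha> where "\<alpha> \<in> {0..<2 * pi}"
    "z \<bullet> (exp (\<i> * complex_of_real \<alpha>) *s v) = norm (cdot z v)"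
proof -
  define w where "w = cdot z v"
  define \<alpha> where "\<alpha> = Arg2pi (cnj w)"
  have "\<alpha> \<in> {0..<2 * pi}"
    unfolding \<alpha>_def using Arg2pi_ge_0 Arg2pi_lt_2pi by auto
  moreover have "Re (exp (\<i> * complex_of_real \<alpha>) * w) = norm w"
  proof (cases "w = 0")
    case False
    have "cnj w = of_real (norm w) * exp (\<i> * complex_of_real \<alpha>)"
      using Arg2pi_eq[of "cnj w"] by (simp add: \<alpha>_def)
    then have "of_real (norm w) * (exp (\<i> * complex_of_real \<alpha>) * w) = of_real (norm w) * of_real (norm w)"
      by (metis complex_norm_square mult.assoc mult.commute power2_eq_square of_real_mult)
    then show ?thesis
      using False by simp
  qed simp
  ultimately show ?thesis
    using that by (simp add: inner_eq_Re_cdot cdot_scale w_def)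
qed

lemma norm_cdot_le: "norm (cdot z v) \<le> norm z * norm v"
proof -
  obtain \<alpha> where "z \<bullet> (exp (\<i> * complex_of_real \<alpha>) *s v) = norm (cdot z v)"
    using exists_aligning_phase by blast
  then show ?thesis
    using norm_cauchy_schwarz[of z "exp (\<i> * complex_of_real \<alpha>) *s v"] by (simp add: norm_scale)
qed

definition outer :: "complex^'n \<Rightarrow> complex^'n^'n" where
  "outer z = (\<chi> i j. z $ i * cnj (z $ j))"

lemma outer_mult_vec: "outer z *v v = cdot z v *s z"
  by (simp add: vec_eq_iff outer_def matrix_vector_mult_def cdot_def sum_distrib_left sum_distrib_right mult_ac)

lemma inner_outer: "v \<bullet> (outer z *v v) = (norm (cdot z v))\<^sup>2"
proof -
  have "cdot v z = cnj (cdot z v)"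
    by (simp add: cdot_def mult.commute)
  then have "cdot v (outer z *v v) = of_real ((norm (cdot z v))\<^sup>2)"
    unfolding complex_norm_square by (simp add: outer_mult_vec cdot_scale)
  then show ?thesis
    by (simp add: inner_eq_Re_cdot)
qed

definition re_trace :: "complex^'n^'n \<Rightarrow> real" where
  "re_trace T = (\<Sum>i\<in>UNIV. Re (T $ i $ i))"

lemma re_trace_outer: "re_trace (outer z) = (norm z)\<^sup>2"
  unfolding norm_vec_power2 cmod_power2 by (simp add: re_trace_def outer_def power2_eq_square)

lemma re_trace_diff: "re_trace (S - T) = re_trace S - re_trace T"
  by (simp add: re_trace_def sum_subtractf)

lemma inner_matrix_sum:
  "v \<bullet> (T *v w) = (\<Sum>i\<in>UNIV. \<Sum>j\<in>UNIV. Re (cnj (v $ i) * T $ i $ j * w $ j))"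
  by (simp add: inner_eq_Re_cdot cdot_def matrix_vector_mult_def sum_distrib_left mult.assoc)

lemma inner_axis_matrix_axis: "axis i c \<bullet> (T *v axis j d) = Re (cnj c * T $ i $ j * d)"
proof -
  have "(T *v axis j d) $ i = T $ i $ j * d"
    by (simp add: matrix_vector_mult_def axis_def if_distrib cong: if_cong)
  then show ?thesis
    by (simp add: inner_axis' inner_complex_def algebra_simps)
qed

lemma psd_re_trace_nonneg:
  assumes "\<And>v. 0 \<le> v \<bullet> (T *v v)"
  shows "0 \<le> re_trace T"
proof -
  have "0 \<le> Re (T $ i $ i)" for i
    using assms[of "axis i 1"] by (simp add: inner_axis_matrix_axis)
  then show ?thesis
    unfolding re_trace_def by (simp add: sum_nonneg)
qed

text \<open>A form that is nonnegative on vectors supported on two coordinates gives an inequality for each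
  pair of coordinates. For the vectors \<open>cnj b\<^sub>j e\<^sub>i - cnj b\<^sub>i e\<^sub>j\<close> the sum over all pairs is
  the claim, as in the proof of Lagrange's identity.\<close>

lemma psd_form_le_re_trace:
  fixes T :: "complex^'n^'n"
  assumes T: "\<And>v. 0 \<le> v \<bullet> (T *v v)"
  shows "b \<bullet> (T *v b) \<le> re_trace T * (norm b)\<^sup>2"
proof -
  let ?x = "\<lambda>i j. axis i (cnj (b $ j)) - axis j (cnj (b $ i))"
  let ?t = "\<lambda>i j. Re (cnj (b $ i) * T $ i $ j * b $ j)"
  let ?d = "\<lambda>i j. Re (T $ i $ i) * (norm (b $ j))\<^sup>2"
  have "?x i j \<bullet> (T *v ?x i j) = ?d i j + ?d j i - ?t i j - ?t j i" for i j
    unfolding cmod_power2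
    by (simp add: inner_diff_left inner_diff_right inner_axis_matrix_axis
        linear_diff[OF linear_matrix_vector_complex] power2_eq_square algebra_simps)
  then have nn: "0 \<le> ?d i j + ?d j i - ?t i j - ?t j i" for i j
    using T by metis
  have "0 \<le> (\<Sum>i\<in>UNIV. \<Sum>j\<in>UNIV. ?d i j + ?d j i - ?t i j - ?t j i)"
    using nn by (intro sum_nonneg)
  also have "\<dots> = 2 * (\<Sum>i\<in>UNIV. \<Sum>j\<in>UNIV. ?d i j) - 2 * (\<Sum>i\<in>UNIV. \<Sum>j\<in>UNIV. ?t i j)"
    using sum.swap[of ?d UNIV UNIV] sum.swap[of ?t UNIV UNIV]
    by (simp add: sum.distrib sum_subtractf)
  also have "(\<Sum>i\<in>UNIV. \<Sum>j\<in>UNIV. ?d i j) = re_trace T * (norm b)\<^sup>2"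
    by (simp add: re_trace_def norm_vec_power2 sum_product)
  also have "(\<Sum>i\<in>UNIV. \<Sum>j\<in>UNIV. ?t i j) = b \<bullet> (T *v b)"
    by (simp add: inner_matrix_sum)
  finally show ?thesis
    by simp
qed

section \<open>The leading eigenvector of a positive semidefinite matrix\<close>

lemma scaleR_eq_scale: "c *\<^sub>R v = complex_of_real c *s (v :: complex^'n)"
  unfolding vec_eq_iff vector_scaleR_component vector_smult_component
  by (simp add: scaleR_conv_of_real)

lemma hermitian_self_adjoint: "hermitian_mat T \<Longrightarrow> v \<bullet> (T *v w) = (T *v v) \<bullet> w"
  using cdot_adj[of v T w] by (simp add: inner_eq_Re_cdot hermitian_mat_def)

text \<open>A Hermitian matrix is self-adjoint for the real inner product, the real part of the Hermitian one. The
  maximum of its form on the unit sphere is therefore one of its real eigenvalues.\<close>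

lemma largest_eigenvalue_bound:
  assumes Y: "hermitian_mat Y" and \<eta>: "is_largest_eigenvalue Y \<eta>"
  shows "v \<bullet> (Y *v v) \<le> \<eta> * (norm v)\<^sup>2"
proof -
  have "(UNIV :: (complex^'a) set) \<noteq> {0}"
    by (metis UNIV_I axis_eq_0_iff singletonD zero_neq_one)
  then obtain w where w: "w \<in> UNIV" "norm w = 1" "Y *v w = (w \<bullet> (Y *v w)) *\<^sub>R w"
    and top: "\<And>x. x \<in> UNIV \<Longrightarrow> x \<bullet> (Y *v x) \<le> (w \<bullet> (Y *v w)) * (norm x)\<^sup>2"
    by (rule rayleigh_maximiser[OF linear_matrix_vector_complex hermitian_self_adjoint[OF Y] subspace_UNIV, rotated])
      (iprover, simp)
  have "eigenvector Y w (complex_of_real (w \<bullet> (Y *v w)))"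
    using w(2,3) unfolding eigenvector_def scaleR_eq_scale by (metis norm_zero zero_neq_one)
  then have "w \<bullet> (Y *v w) \<le> \<eta>"
    using \<eta> unfolding is_largest_eigenvalue_def eigenvalues_def by blast
  then have "(w \<bullet> (Y *v w)) * (norm v)\<^sup>2 \<le> \<eta> * (norm v)\<^sup>2"
    by (rule mult_right_mono) simp
  then show ?thesis
    using top[of v] by simp
qed

text \<open>The value of the deflated form at \<open>v\<close> is the value of \<open>Y\<close> at the component of \<open>v\<close> orthogonal to
  the eigenvector.\<close>

lemma deflation_psd:
  assumes Y: "psd_mat Y" and y: "eigenvector Y y (complex_of_real \<eta>)" "norm y = 1" and \<eta>: "\<eta> \<ge> 0"
  shows "0 \<le> v \<bullet> ((Y - outer (complex_of_real (sqrt \<eta>) *s y)) *v v)"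
proof -
  define c where "c = cdot y v"
  define w where "w = v - c *s y"
  have herm: "hermitian_mat Y"
    using Y by (simp add: psd_mat_iff)
  have Yc: "Y *v (c *s y) = \<eta> *\<^sub>R (c *s y)"
    using y(1) by (simp add: eigenvector_def scaleR_eq_scale vec.scale mult.commute)
  have cv: "(c *s y) \<bullet> v = (norm c)\<^sup>2"
    unfolding cmod_power2 by (simp add: inner_eq_Re_cdot cdot_scale c_def[symmetric] power2_eq_square)
  have cc: "(c *s y) \<bullet> (c *s y) = (norm c)\<^sup>2"
    using y(2) by (simp add: power2_norm_eq_inner[symmetric] norm_scale)
  have "w \<bullet> (Y *v w) = v \<bullet> (Y *v v) - v \<bullet> (Y *v (c *s y)) - (c *s y) \<bullet> (Y *v v)
      + (c *s y) \<bullet> (Y *v (c *s y))"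
    by (simp add: w_def inner_diff_left inner_diff_right linear_diff[OF linear_matrix_vector_complex])
  also have "(c *s y) \<bullet> (Y *v v) = (Y *v (c *s y)) \<bullet> v"
    by (rule hermitian_self_adjoint[OF herm])
  also have "v \<bullet> (Y *v v) - v \<bullet> (Y *v (c *s y)) - (Y *v (c *s y)) \<bullet> v + (c *s y) \<bullet> (Y *v (c *s y))
      = v \<bullet> (Y *v v) - \<eta> * (norm c)\<^sup>2"
    using inner_commute[of v "c *s y"] by (simp add: Yc cv cc)
  also have "\<dots> = v \<bullet> ((Y - outer (complex_of_real (sqrt \<eta>) *s y)) *v v)"
    using \<eta> by (simp add: matrix_vector_mult_diff_rdistrib inner_diff_right inner_outer cdot_scale
        norm_mult power_mult_distrib c_def)
  finally show ?thesis
    using Y by (metis psd_mat_iff)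
qed

section \<open>From an approximate Gram matrix to the vector\<close>

text \<open>Removing the phases of \<open>b\<close> turns the complex form \<open>Y\<close> into a real one, to which the real
  Laplacian applies. The trace is kept only if all the phases are unimodular, also where \<open>b\<close>
  vanishes; \<open>cis (Arg (b $ i))\<close> is then \<open>1\<close>.\<close>

lemma gauge_to_real:
  fixes b :: "complex^'m" and Y :: "complex^'m^'m"
  obtains u :: "'m \<Rightarrow> complex" and S :: "real^'m^'m"
  where "\<And>i. norm (u i) = 1" "\<And>i. b $ i = u i * of_real (norm (b $ i))"
    "\<And>i j. S $ i $ j = Re (cnj (u i) * Y $ i $ j * u j)"
    "\<And>v. v \<bullet> (S *v v) = (\<chi> i. u i * of_real (v $ i)) \<bullet> (Y *v (\<chi> i. u i * of_real (v $ i)))"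
    "trace S = re_trace Y" "modulus b \<bullet> (S *v modulus b) = b \<bullet> (Y *v b)"
proof -
  define u where "u i = cis (Arg (b $ i))" for i
  define S :: "real^'m^'m" where "S = (\<chi> i j. Re (cnj (u i) * Y $ i $ j * u j))"
  have nu: "norm (u i) = 1" for i
    by (simp add: u_def)
  have bu: "b $ i = u i * of_real (norm (b $ i))" for i
    using rcis_cmod_Arg[of "b $ i"] by (simp add: u_def rcis_def mult.commute)
  have re: "Re (of_real x * w) = x * Re w" for x w
    by simp
  have form: "v \<bullet> (S *v v) = (\<chi> i. u i * of_real (v $ i)) \<bullet> (Y *v (\<chi> i. u i * of_real (v $ i)))" for v
  proof -
    have entry: "v $ i * S $ i $ j * v $ j
        = Re (cnj (u i * of_real (v $ i)) * Y $ i $ j * (u j * of_real (v $ j)))" for i j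
    proof -
      have "cnj (u i * of_real (v $ i)) * Y $ i $ j * (u j * of_real (v $ j))
          = of_real (v $ i * v $ j) * (cnj (u i) * Y $ i $ j * u j)"
        by (simp add: mult_ac)
      then show ?thesis
        by (simp only: re) (simp only: S_def vec_lambda_beta mult_ac)
    qed
    have "v \<bullet> (S *v v) = (\<Sum>i\<in>UNIV. \<Sum>j\<in>UNIV. v $ i * S $ i $ j * v $ j)"
      by (simp add: inner_vec_def matrix_vector_mult_def sum_distrib_left mult.assoc)
    then show ?thesis
      by (simp only: entry inner_matrix_sum vec_lambda_beta)
  qed
  have "cnj (u i) * u i = 1" for i
    using complex_norm_square[of "u i"] by (simp add: nu mult.commute)
  then have diag: "cnj (u i) * Y $ i $ i * u i = Y $ i $ i" for i
    by (metis mult.assoc mult.commute mult_1)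
  have tr: "trace S = re_trace Y"
    by (simp only: trace_def re_trace_def S_def vec_lambda_beta diag)
  have "(\<chi> i. u i * of_real (modulus b $ i)) = b"
    using bu by (simp add: vec_eq_iff modulus_nth)
  then have "modulus b \<bullet> (S *v modulus b) = b \<bullet> (Y *v b)"
    using form[of "modulus b"] by simp
  then show ?thesis
    using that[of u S] nu bu form tr by (simp add: S_def)
qed

text \<open>The left-hand side measures how much of \<open>Y\<close> lies off the direction of \<open>b\<close>. After the phases are
  removed, the trace of \<open>Y\<close> against the Laplacian bounds it from above by the trace bound. That trace is small:
  the Laplacian lives on \<open>E \<union> Id\<close> and annihilates the matrix of \<open>b\<close>, so it only sees the deviation
  on the measured entries, and its own entries are at most \<open>(norm b)\<^sup>2\<close>.\<close>

lemma psd_near_rank_one: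
  fixes b :: "complex^'m" and Y :: "complex^'m^'m"
  assumes E: "sym E" "\<forall>(i, j)\<in>E. i \<noteq> j" and b: "b \<noteq> 0"
    and pos: "0 < second_smallest_eigenvalue (weighted_laplacian E b)"
    and Y: "\<And>v. 0 \<le> v \<bullet> (Y *v v)"
    and dev: "(\<Sum>(i, j)\<in>E \<union> Id. norm (Y $ i $ j - b $ i * cnj (b $ j))) \<le> \<delta>"
  shows "second_smallest_eigenvalue (weighted_laplacian E b)
      * (re_trace Y - (b \<bullet> (Y *v b)) / (norm b)\<^sup>2) \<le> (norm b)\<^sup>2 * \<delta>"
proof -
  let ?L = "weighted_laplacian E b"
  obtain u :: "'m \<Rightarrow> complex" and S :: "real^'m^'m"
    where nu: "\<And>i. norm (u i) = 1" and bu: "\<And>i. b $ i = u i * of_real (norm (b $ i))"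
      and S: "\<And>i j. S $ i $ j = Re (cnj (u i) * Y $ i $ j * u j)"
      and form: "\<And>v. v \<bullet> (S *v v) = (\<chi> i. u i * of_real (v $ i)) \<bullet> (Y *v (\<chi> i. u i * of_real (v $ i)))"
      and tr: "trace S = re_trace Y" and Sb: "modulus b \<bullet> (S *v modulus b) = b \<bullet> (Y *v b)"
    using gauge_to_real by blast
  define \<Delta> where "\<Delta> i j = Y $ i $ j - b $ i * cnj (b $ j)" for i j
  have uu: "cnj (u i) * u i = 1" for i
    using complex_norm_square[of "u i"] by (simp add: nu mult.commute)
  have "S $ i $ j - modulus b $ i * modulus b $ j = Re (cnj (u i) * \<Delta> i j * u j)" for i j
  proof -
    have "cnj (u i) * (b $ i * cnj (b $ j)) * u j
        = (cnj (u i) * u i) * (cnj (u j) * u j) * of_real (norm (b $ i) * norm (b $ j))"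
      by (subst bu[of i], subst bu[of j]) (simp add: mult_ac)
    also have "\<dots> = of_real (norm (b $ i) * norm (b $ j))"
      by (simp add: uu)
    finally have "Re (cnj (u i) * (b $ i * cnj (b $ j)) * u j) = norm (b $ i) * norm (b $ j)"
      by (simp only: Re_complex_of_real)
    moreover have "cnj (u i) * \<Delta> i j * u j
        = cnj (u i) * Y $ i $ j * u j - cnj (u i) * (b $ i * cnj (b $ j)) * u j"
      by (simp add: \<Delta>_def algebra_simps)
    ultimately show ?thesis
      by (simp only: S modulus_nth minus_complex.simps)
  qed
  then have dS: "\<bar>S $ i $ j - modulus b $ i * modulus b $ j\<bar> \<le> norm (\<Delta> i j)" for i j
    using abs_Re_le_cmod[of "cnj (u i) * \<Delta> i j * u j"] by (simp add: norm_mult nu)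
  have "modulus b \<noteq> 0"
    using b norm_modulus[of b] by auto
  then have "second_smallest_eigenvalue ?L * (trace S - (modulus b \<bullet> (S *v modulus b)) / (norm (modulus b))\<^sup>2)
      \<le> trace (S ** ?L)"
    by (rule second_eigenvalue_trace_bound[OF laplacian_symmetric[OF E(1)] laplacian_modulus[OF E(2)] _ pos])
      (simp add: form Y)
  also have "trace (S ** ?L) = (\<Sum>i\<in>UNIV. \<Sum>j\<in>UNIV. S $ i $ j * ?L $ j $ i)"
    by (simp add: trace_def matrix_matrix_mult_def)
  also have "\<dots> = (\<Sum>i\<in>UNIV. \<Sum>j\<in>UNIV. S $ i $ j * ?L $ i $ j)"
  proof -
    have "?L $ j $ i = ?L $ i $ j" for i j
      using laplacian_symmetric[OF E(1), of b] by (simp add: transpose_def vec_eq_iff)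
    then show ?thesis by simp
  qed
  also have "\<dots> = (\<Sum>i\<in>UNIV. \<Sum>j\<in>UNIV. (S $ i $ j - modulus b $ i * modulus b $ j) * ?L $ i $ j)"
  proof -
    have "(\<Sum>j\<in>UNIV. modulus b $ i * modulus b $ j * ?L $ i $ j) = modulus b $ i * (?L *v modulus b) $ i" for i
      by (simp add: matrix_vector_mult_def sum_distrib_left mult_ac)
    also have "\<dots> i = 0" for i
      by (simp add: laplacian_modulus[OF E(2)])
    finally show ?thesis
      by (simp add: left_diff_distrib sum_subtractf)
  qed
  also have "\<dots> = (\<Sum>(i, j)\<in>UNIV. (S $ i $ j - modulus b $ i * modulus b $ j) * ?L $ i $ j)"
    by (simp add: sum.cartesian_product)
  also have "\<dots> = (\<Sum>(i, j)\<in>E \<union> Id. (S $ i $ j - modulus b $ i * modulus b $ j) * ?L $ i $ j)"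
    by (rule sum.mono_neutral_right) (auto simp: weighted_laplacian_def split: if_splits)
  also have "\<dots> \<le> (\<Sum>(i, j)\<in>E \<union> Id. (norm b)\<^sup>2 * norm (\<Delta> i j))"
  proof (rule sum_mono, clarify)
    fix i j
    have "(S $ i $ j - modulus b $ i * modulus b $ j) * ?L $ i $ j
        \<le> \<bar>S $ i $ j - modulus b $ i * modulus b $ j\<bar> * \<bar>?L $ i $ j\<bar>"
      by (metis abs_ge_self abs_mult)
    also have "\<dots> \<le> norm (\<Delta> i j) * (norm b)\<^sup>2"
      using dS laplacian_entry_le[OF E(2)] by (intro mult_mono) auto
    finally show "(S $ i $ j - modulus b $ i * modulus b $ j) * ?L $ i $ j \<le> (norm b)\<^sup>2 * norm (\<Delta> i j)"
      by (simp add: mult.commute)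
  qed
  also have "\<dots> = (norm b)\<^sup>2 * (\<Sum>(i, j)\<in>E \<union> Id. norm (Y $ i $ j - b $ i * cnj (b $ j)))"
    by (simp add: sum_distrib_left \<Delta>_def case_prod_unfold)
  also have "\<dots> \<le> (norm b)\<^sup>2 * \<delta>"
    using dev by (rule mult_left_mono) simp
  finally show ?thesis
    by (simp add: tr Sb norm_modulus)
qed

lemma re_trace_deviation:
  fixes b :: "complex^'m" and Y :: "complex^'m^'m"
  assumes dev: "(\<Sum>(i, j)\<in>E \<union> Id. norm (Y $ i $ j - b $ i * cnj (b $ j))) \<le> \<delta>"
  shows "\<bar>re_trace Y - (norm b)\<^sup>2\<bar> \<le> \<delta>"
proof -
  have "re_trace Y - (norm b)\<^sup>2 = (\<Sum>i\<in>UNIV. Re (Y $ i $ i - b $ i * cnj (b $ i)))"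
    unfolding re_trace_outer[symmetric] re_trace_diff[symmetric] by (simp add: re_trace_def outer_def)
  also have "\<bar>\<dots>\<bar> \<le> (\<Sum>i\<in>UNIV. norm (Y $ i $ i - b $ i * cnj (b $ i)))"
    by (intro order_trans[OF sum_abs] sum_mono abs_Re_le_cmod)
  also have "\<dots> = (\<Sum>(i, j)\<in>Id. norm (Y $ i $ j - b $ i * cnj (b $ j)))"
    by (rule sum.reindex_bij_witness[of _ fst "\<lambda>i. (i, i)"]) auto
  also have "\<dots> \<le> (\<Sum>(i, j)\<in>E \<union> Id. norm (Y $ i $ j - b $ i * cnj (b $ j)))"
    by (rule sum_mono2) auto
  finally show ?thesis
    using dev by simp
qed

text \<open>The factor \<open>z\<close> stands for \<open>A x\<close> with \<open>Y = z z\<^sup>*\<close>, or for the scaled leading eigenvector of \<open>Y\<close>;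
  the two hypotheses on forms hold in both cases. Put \<open>r = |b|\<^sup>2\<close> and \<open>t = \<delta> / l\<close>.
  Almost all of \<open>Y\<close> lies along \<open>b\<close>, up to \<open>r t\<close>. Maximality of \<open>|z|\<^sup>2\<close> therefore forces
  \<open>|z|\<^sup>2 \<ge> r - 2 r t\<close>. The part of \<open>z z\<^sup>*\<close> off \<open>b\<close> is at most that of \<open>Y\<close>, because the
  remainder \<open>Y - z z\<^sup>*\<close> is positive semidefinite; hence \<open>z\<close> is nearly parallel to \<open>b\<close>.\<close>

lemma leading_factor_close:
  fixes b z :: "complex^'m" and Y :: "complex^'m^'m"
  assumes N: "CARD('m) \<ge> 2" and E: "sym E" "\<forall>(i, j)\<in>E. i \<noteq> j"
    and l: "l = second_smallest_eigenvalue (weighted_laplacian E b)" "0 < l"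
    and dev: "(\<Sum>(i, j)\<in>E \<union> Id. norm (Y $ i $ j - b $ i * cnj (b $ j))) \<le> \<delta>"
    and rest: "\<And>v. 0 \<le> v \<bullet> ((Y - outer z) *v v)"
    and top: "\<And>v. v \<bullet> (Y *v v) \<le> (norm z)\<^sup>2 * (norm v)\<^sup>2"
  obtains \<alpha> where "\<alpha> \<in> {0..<2 * pi}"
    "(norm (z - exp (\<i> * complex_of_real \<alpha>) *s b))\<^sup>2 \<le> 7 * (norm b)\<^sup>2 * (\<delta> / l)"
proof -
  have b: "b \<noteq> 0"
    using laplacian_positive_imp_nonzero[OF N, of E b] l by simp
  define r where "r = (norm b)\<^sup>2"
  define s where "s = (norm z)\<^sup>2"
  define p where "p = norm (cdot z b)"
  define t where "t = \<delta> / l"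
  define q where "q = b \<bullet> (Y *v b) / r"
  have r0: "r > 0"
    using b by (simp add: r_def)
  have split: "v \<bullet> ((Y - outer z) *v v) = v \<bullet> (Y *v v) - (norm (cdot z v))\<^sup>2" for v
    by (simp add: matrix_vector_mult_diff_rdistrib inner_diff_right inner_outer)
  have Y: "0 \<le> v \<bullet> (Y *v v)" for v
    using rest[of v] unfolding split by (smt (verit) zero_le_power2)
  have \<delta>0: "\<delta> \<ge> 0"
    using dev by (smt (verit) sum_nonneg norm_ge_zero case_prod_unfold)
  have t0: "t \<ge> 0"
    using \<delta>0 l(2) by (simp add: t_def)
  have "l \<le> r"
    using laplacian_second_eigenvalue_le[OF N E, of b] l by (simp add: r_def)
  have \<delta>t: "\<delta> \<le> r * t"
  proof -
    have "\<delta> = l * t"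
      using l(2) by (simp add: t_def)
    then show ?thesis
      using \<open>l \<le> r\<close> t0 by (simp add: mult_right_mono)
  qed
  have tr: "r - \<delta> \<le> re_trace Y" "re_trace Y \<le> r + \<delta>"
    using re_trace_deviation[OF dev] by (simp_all add: r_def abs_le_iff)
  have "l * (re_trace Y - q) \<le> r * \<delta>"
    using psd_near_rank_one[OF E b _ Y dev] l by (simp add: r_def q_def)
  then have q: "re_trace Y - q \<le> r * t"
    using l(2) by (simp add: t_def pos_le_divide_eq mult.commute)
  have qs: "q \<le> s"
    using top[of b] r0 by (simp add: q_def s_def r_def pos_divide_le_eq)
  have "(b \<bullet> ((Y - outer z) *v b)) \<le> re_trace (Y - outer z) * (norm b)\<^sup>2"
    using rest by (rule psd_form_le_re_trace)
  then have "q * r - p\<^sup>2 \<le> (re_trace Y - s) * r"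
    using r0 by (simp add: split re_trace_diff re_trace_outer q_def p_def s_def r_def)
  then have p2: "r * (s - (re_trace Y - q)) \<le> p\<^sup>2"
    by (simp add: algebra_simps)
  have "0 \<le> re_trace (Y - outer z)"
    using rest by (rule psd_re_trace_nonneg)
  then have s_le: "s \<le> r + r * t"
    using tr \<delta>t by (simp add: re_trace_diff re_trace_outer s_def)
  have s_ge: "s \<ge> r - 2 * (r * t)"
    using qs q tr \<delta>t by linarith
  have p0: "p \<ge> 0"
    by (simp add: p_def)
  \<comment> \<open>For small \<open>t\<close> the overlap \<open>p\<close> is at least \<open>r (1 - 3 t)\<close>; for \<open>t > 1/3\<close> the crude bound
    \<open>s + r \<le> 2 r + r t\<close> already suffices.\<close>
  have main: "s + r - 2 * p \<le> 7 * r * t"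
  proof (cases "3 * t \<le> 1")
    case True
    have "r * (r - 3 * (r * t)) \<le> r * (s - (re_trace Y - q))"
      using s_ge q r0 by (intro mult_left_mono) auto
    then have "(r * r) * (1 - 3 * t) \<le> p\<^sup>2"
      using p2 by (simp add: algebra_simps)
    moreover have "(1 - 3 * t)\<^sup>2 \<le> 1 - 3 * t"
      using True t0 by (simp add: power2_eq_square mult_left_le)
    then have "(r * r) * (1 - 3 * t)\<^sup>2 \<le> (r * r) * (1 - 3 * t)"
      using r0 by (intro mult_left_mono) auto
    ultimately have "(r * (1 - 3 * t))\<^sup>2 \<le> p\<^sup>2"
      by (simp add: power2_eq_square algebra_simps)
    then have "r * (1 - 3 * t) \<le> p"
      using p0 by (rule power2_le_imp_le)
    then show ?thesis
      using s_le by (simp add: algebra_simps)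
  next
    case False
    then have "r \<le> r * (3 * t)"
      using r0 by simp
    then show ?thesis
      using s_le p0 by (simp add: algebra_simps)
  qed
  obtain \<alpha> where \<alpha>: "\<alpha> \<in> {0..<2 * pi}" "z \<bullet> (exp (\<i> * complex_of_real \<alpha>) *s b) = p"
    unfolding p_def using exists_aligning_phase by blast
  have "(norm (z - exp (\<i> * complex_of_real \<alpha>) *s b))\<^sup>2
      = s + (norm (exp (\<i> * complex_of_real \<alpha>) *s b))\<^sup>2 - 2 * p"
    unfolding \<alpha>(2)[symmetric] s_def power2_norm_eq_inner
    by (simp add: inner_diff_left inner_diff_right inner_commute)
  also have "\<dots> = s + r - 2 * p"
    by (simp add: norm_scale r_def)
  finally show ?thesis
    using that[OF \<alpha>(1)] main by (simp add: r_def t_def)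
qed

section \<open>The pseudoinverse of a left-invertible matrix\<close>

lemma adj_mat_mult: "adj_mat (A ** B) = adj_mat B ** adj_mat A"
  by (simp add: vec_eq_iff adj_mat_def matrix_matrix_mult_def mult.commute)

lemma adj_mat_adj_mat: "adj_mat (adj_mat A) = A"
  by (simp add: vec_eq_iff adj_mat_def)

lemma adj_mat_one: "adj_mat (mat 1) = mat 1"
  by (simp add: vec_eq_iff adj_mat_def mat_def)

lemma is_pinv_left_inverse:
  assumes "A' ** A = mat 1" "is_pinv A P"
  shows "P ** A = mat 1"
proof -
  have "P ** A = (A' ** A) ** (P ** A)"
    by (simp add: assms(1))
  also have "\<dots> = A' ** (A ** P ** A)"
    by (simp add: matrix_mul_assoc)
  also have "\<dots> = mat 1"
    using assms by (simp add: is_pinv_def)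
  finally show ?thesis .
qed

text \<open>Both \<open>A ** P\<close> and \<open>A ** Q\<close> are the orthogonal projection onto the range of \<open>A\<close>, hence equal, and \<open>A\<close> can
  be cancelled on the left.\<close>

lemma is_pinv_unique:
  assumes A': "A' ** A = mat 1" and P: "is_pinv A P" and Q: "is_pinv A Q"
  shows "P = Q"
proof -
  have "A ** P = adj_mat (A ** Q ** A ** P)"
    using P Q by (simp add: is_pinv_def hermitian_mat_def)
  also have "\<dots> = adj_mat (A ** P) ** adj_mat (A ** Q)"
    unfolding adj_mat_mult[symmetric] by (simp add: matrix_mul_assoc)
  also have "\<dots> = A ** P ** (A ** Q)"
    using P Q by (simp add: is_pinv_def hermitian_mat_def)
  also have "\<dots> = A ** Q"
    using P by (simp add: is_pinv_def matrix_mul_assoc)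
  finally have "P ** (A ** P) = P ** (A ** Q)"
    by simp
  then show ?thesis
    using is_pinv_left_inverse[OF A' P] P by (simp add: is_pinv_def matrix_mul_assoc)
qed

text \<open>The witness is \<open>(A\<^sup>* A)\<^bsup>-1\<^esup> A\<^sup>*\<close>: its form at \<open>v\<close> is
  \<open>|A v|\<^sup>2\<close>, so the Gram matrix inherits injectivity from \<open>A\<close>.\<close>

lemma is_pinv_exists:
  fixes A :: "complex^'n^'m"
  assumes A': "A' ** A = mat 1"
  shows "\<exists>P. is_pinv A P"
proof -
  let ?G = "adj_mat A ** A"
  have "v = 0" if "?G *v v = 0" for v
  proof -
    have "cdot (A *v v) (A *v v) = cdot v (?G *v v)"
      by (simp add: cdot_adj[symmetric] matrix_vector_mul_assoc)
    then have "A *v v = 0"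
      using that by (simp add: cdot_self cdot_def[of v 0])
    then have "A' *v (A *v v) = 0"
      by simp
    then show ?thesis
      by (simp add: matrix_vector_mul_assoc A')
  qed
  then obtain C where C: "C ** ?G = mat 1"
    by (metis matrix_left_invertible_ker)
  then have C': "?G ** C = mat 1"
    by (simp add: matrix_left_right_inverse)
  have "adj_mat C = C ** ?G ** adj_mat C"
    by (simp add: C)
  also have "\<dots> = C ** adj_mat (C ** ?G)"
    by (simp add: adj_mat_mult adj_mat_adj_mat matrix_mul_assoc)
  finally have "adj_mat C = C"
    by (simp add: C adj_mat_one)
  then have "hermitian_mat (A ** (C ** adj_mat A))"
    by (simp add: hermitian_mat_def adj_mat_mult adj_mat_adj_mat matrix_mul_assoc)
  moreover have "C ** adj_mat A ** A = mat 1"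
    using C by (simp add: matrix_mul_assoc)
  ultimately have "is_pinv A (C ** adj_mat A)"
    unfolding is_pinv_def
    by (metis adj_mat_one hermitian_mat_def matrix_mul_assoc matrix_mul_lid matrix_mul_rid)
  then show ?thesis ..
qed

lemma pinv_left_inverse:
  assumes "A' ** A = mat 1"
  shows "pinv A ** A = mat 1"
proof -
  have "\<exists>!P. is_pinv A P"
    using is_pinv_exists[OF assms] is_pinv_unique[OF assms] by blast
  then have "is_pinv A (pinv A)"
    unfolding pinv_def by (rule theI')
  then show ?thesis
    by (rule is_pinv_left_inverse[OF assms])
qed

lemma norm_matrix_vector_le: "norm (A *v v) \<le> spectral_norm A * norm (v :: complex^'n)"
  unfolding spectral_norm_def
  by (rule onorm) (use linear_matrix_vector_complex linear_conv_bounded_linear in blast)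

lemma spectral_norm_nonneg: "0 \<le> spectral_norm (A :: complex^'n^'m)"
  unfolding spectral_norm_def
  by (rule onorm_pos_le) (use linear_matrix_vector_complex linear_conv_bounded_linear in blast)

section \<open>Stability of the recovery\<close>

theorem theorem5:
  fixes A :: "complex^'n^'m"
    and x0 x :: "complex^'n"
    and b :: "complex^'m"
    and E D :: "('m \<times> 'm) set"
    and B \<epsilon> :: "'m \<Rightarrow> 'm \<Rightarrow> complex"
    and \<sigma> lam2 \<epsilon>norm :: real
  assumes "\<exists>A'. A' ** A = mat 1"
    and "b = A *v x0"
    and "CARD('m) \<ge> 2"
    and "sym E"
    and "\<forall>(i, j)\<in>E. i \<noteq> j"
    and "D = {(i, i) | i. True}"
    and "\<forall>(i, j)\<in>E \<union> D. B i j = b $ i * cnj (b $ j) + \<epsilon> i j"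
    and "\<forall>(i, j)\<in>E \<union> D. \<epsilon> i j = cnj (\<epsilon> j i)"
    and "\<epsilon>norm = (\<Sum>(i, j)\<in>E \<union> D. norm (\<epsilon> i j))"
    and "\<sigma> \<ge> 0"
    and "lam2 = second_smallest_eigenvalue (weighted_laplacian E b)"
    and "lam2 > 0"
    and "\<epsilon>norm + \<sigma> \<le> lam2 / 2"
    and "(\<Sum>(i, j)\<in>E \<union> D. norm ((A *v x) $ i * cnj ((A *v x) $ j) - B i j)) \<le> \<sigma>
       \<or> (\<exists>Y \<eta>1 y1.
            psd_mat Y
          \<and> (\<Sum>(i, j)\<in>E \<union> D. norm (Y $ i $ j - B i j)) \<le> \<sigma>
          \<and> is_largest_eigenvalue Y \<eta>1
          \<and> eigenvector Y y1 (complex_of_real \<eta>1) \<and> norm y1 = 1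
          \<and> x = complex_of_real (sqrt \<eta>1) *s (pinv A *v y1))"
  shows "\<exists>\<alpha>\<in>{0..<2 * pi}.
           norm (x - exp (\<i> * complex_of_real \<alpha>) *s x0) / norm x0
             \<le> 15 * cond_number A * sqrt ((\<epsilon>norm + \<sigma>) / lam2)"
proof -
  have D: "D = Id"
    using assms(6) by auto
  have PA: "pinv A ** A = mat 1"
    using assms(1) pinv_left_inverse by blast
  have dev: "(\<Sum>(i, j)\<in>E \<union> Id. norm (Y $ i $ j - b $ i * cnj (b $ j))) \<le> \<epsilon>norm + \<sigma>"
    if "(\<Sum>(i, j)\<in>E \<union> D. norm (Y $ i $ j - B i j)) \<le> \<sigma>" for Y :: "complex^'m^'m"
  proof -
    have "(\<Sum>(i, j)\<in>E \<union> D. norm (Y $ i $ j - b $ i * cnj (b $ j)))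
        \<le> (\<Sum>(i, j)\<in>E \<union> D. norm (\<epsilon> i j) + norm (Y $ i $ j - B i j))"
    proof (rule sum_mono, clarify)
      fix i j assume "(i, j) \<in> E \<union> D"
      then have "Y $ i $ j - b $ i * cnj (b $ j) = \<epsilon> i j + (Y $ i $ j - B i j)"
        using bspec[OF assms(7), of "(i, j)"] by simp
      then show "norm (Y $ i $ j - b $ i * cnj (b $ j)) \<le> norm (\<epsilon> i j) + norm (Y $ i $ j - B i j)"
        by (simp only: norm_triangle_ineq)
    qed
    also have "\<dots> = \<epsilon>norm + (\<Sum>(i, j)\<in>E \<union> D. norm (Y $ i $ j - B i j))"
      by (simp add: assms(9) case_prod_unfold sum.distrib)
    finally show ?thesis
      using that D by simp
  qed
  \<comment> \<open>Both ways of obtaining \<open>x\<close> factor through a vector \<open>z\<close> with \<open>x = pinv A z\<close>: the first has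
    \<open>z = A x\<close> and \<open>Y = z z\<^sup>*\<close>, the second the scaled leading eigenvector.\<close>
  obtain Y z where Y: "(\<Sum>(i, j)\<in>E \<union> D. norm (Y $ i $ j - B i j)) \<le> \<sigma>"
    and rest: "\<And>v. 0 \<le> v \<bullet> ((Y - outer z) *v v)"
    and top: "\<And>v. v \<bullet> (Y *v v) \<le> (norm z)\<^sup>2 * (norm v)\<^sup>2"
    and x: "x = pinv A *v z"
    using assms(14)
  proof (elim disjE exE conjE)
    assume "(\<Sum>(i, j)\<in>E \<union> D. norm ((A *v x) $ i * cnj ((A *v x) $ j) - B i j)) \<le> \<sigma>"
    then have "(\<Sum>(i, j)\<in>E \<union> D. norm (outer (A *v x) $ i $ j - B i j)) \<le> \<sigma>"
      by (simp add: outer_def)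
    moreover have "v \<bullet> (outer (A *v x) *v v) \<le> (norm (A *v x))\<^sup>2 * (norm v)\<^sup>2" for v
      unfolding inner_outer power_mult_distrib[symmetric]
      by (intro power_mono norm_cdot_le) simp
    moreover have "x = pinv A *v (A *v x)"
      by (simp add: matrix_vector_mul_assoc PA)
    ultimately show thesis
      by (intro that[of "outer (A *v x)" "A *v x"]) auto
  next
    fix Y \<eta> y
    assume Y: "psd_mat Y" "(\<Sum>(i, j)\<in>E \<union> D. norm (Y $ i $ j - B i j)) \<le> \<sigma>"
      and \<eta>: "is_largest_eigenvalue Y \<eta>" and y: "eigenvector Y y (complex_of_real \<eta>)" "norm y = 1"
      and x: "x = complex_of_real (sqrt \<eta>) *s (pinv A *v y)"
    let ?z = "complex_of_real (sqrt \<eta>) *s y"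
    have herm: "hermitian_mat Y"
      using Y by (simp add: psd_mat_iff)
    have "y \<bullet> (Y *v y) = \<eta>"
      using y by (simp add: eigenvector_def inner_eq_Re_cdot cdot_scale cdot_self)
    then have \<eta>0: "\<eta> \<ge> 0"
      using Y(1) by (metis psd_mat_iff)
    then have "(norm ?z)\<^sup>2 = \<eta>"
      using y(2) by (simp add: norm_scale)
    moreover have "x = pinv A *v ?z"
      by (simp add: x vec.scale)
    ultimately show thesis
      using Y(2) deflation_psd[OF Y(1) y \<eta>0] largest_eigenvalue_bound[OF herm \<eta>]
      by (intro that[of Y ?z]) auto
  qed
  define t where "t = (\<epsilon>norm + \<sigma>) / lam2"
  have t0: "t \<ge> 0"
    using assms(9,10,12) by (simp add: t_def sum_nonneg case_prod_unfold)
  obtain \<alpha> where \<alpha>: "\<alpha> \<in> {0..<2 * pi}"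
    and close: "(norm (z - exp (\<i> * complex_of_real \<alpha>) *s b))\<^sup>2 \<le> 7 * (norm b)\<^sup>2 * t"
    unfolding t_def by (rule leading_factor_close[OF assms(3,4,5,11,12) dev[OF Y] rest top])
  let ?e = "exp (\<i> * complex_of_real \<alpha>)"
  have "norm (z - ?e *s b) \<le> 15 * norm b * sqrt t"
  proof (rule power2_le_imp_le)
    have "7 * (norm b)\<^sup>2 * t \<le> 225 * (norm b)\<^sup>2 * t"
      using t0 by (intro mult_right_mono) auto
    from order_trans[OF close this] show "(norm (z - ?e *s b))\<^sup>2 \<le> (15 * norm b * sqrt t)\<^sup>2"
      using t0 by (simp add: power_mult_distrib)
  qed (use t0 in auto)
  moreover have "norm b \<le> spectral_norm A * norm x0"
    unfolding assms(2) by (rule norm_matrix_vector_le)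
  ultimately have *: "norm (z - ?e *s b) \<le> 15 * (spectral_norm A * norm x0) * sqrt t"
    using t0 by (smt (verit) mult_left_mono mult_right_mono real_sqrt_ge_zero)
  have "x - ?e *s x0 = pinv A *v (z - ?e *s b)"
    by (simp add: x assms(2) vec.diff vec.scale matrix_vector_mul_assoc PA)
  then have "norm (x - ?e *s x0) \<le> spectral_norm (pinv A) * norm (z - ?e *s b)"
    by (simp only: norm_matrix_vector_le)
  also have "\<dots> \<le> spectral_norm (pinv A) * (15 * (spectral_norm A * norm x0) * sqrt t)"
    using * by (rule mult_left_mono) (rule spectral_norm_nonneg)
  finally have "norm (x - ?e *s x0) \<le> (15 * cond_number A * sqrt t) * norm x0"
    by (simp add: cond_number_def mult_ac)
  moreover have "x0 \<noteq> 0"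
    using laplacian_positive_imp_nonzero[OF assms(3), of E b] assms(2,11,12) by auto
  ultimately have "norm (x - ?e *s x0) / norm x0 \<le> 15 * cond_number A * sqrt t"
    by (simp add: pos_divide_le_eq)
  then show ?thesis
    using \<alpha> unfolding t_def by blast
qed

end
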